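(* Let $W>0$, $K^*=2\lceil W\rceil+1$, $\gamma_{\mathrm{th}}>0$, and let $N\ge K^*$ be an integer. Let $\beta_k=\lambda_kK^*/N$ for $k=1,\dots,K^*$, where $\lambda_1\ge\cdots\ge\lambda_N\ge 0$ are the eigenvalues of the $N\times N$ Jakes correlation matrix, with $\lambda_1,\dots,\lambda_{K^*}>0$. Then the refined WIM outage approximation $$P_{\mathrm{out}}^{\mathrm{Ref}}(x)=\prod_{k=1}^{K^*}\left(1-e^{-x/\beta_k}\right),\qquad x=\frac{\gamma_{\mathrm{th}}}{\bar\gamma},$$ achieves diversity order $K^*$, i.e. $$-\lim_{\bar\gamma\to\infty}\frac{\log P_{\mathrm{out}}^{\mathrm{Ref}}(\gamma_{\mathrm{th}}/\bar\gamma)}{\log\bar\gamma}=K^*.$$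
   Context: $W$ is the normalized aperture of a linear fluid antenna with $N$ ports, $\bar\gamma>0$ is the average SNR, $\gamma_{\mathrm{th}}$ is the outage threshold. The Jakes correlation matrix $\mathbf R\in\mathbb R^{N\times N}$ has entries $[\mathbf R]_{m,n}=J_0\!\left(\frac{2\pi W|m-n|}{N-1}\right)$, where $J_0$ is the zeroth-order Bessel function of the first kind. "WIM" stands for weighted independent modes. *)

theory Defs
  imports Complex_Main "Jordan_Normal_Form.Char_Poly"
begin

definition bessel_J0 :: "real \<Rightarrow> real" where
  "bessel_J0 x = (\<Sum>m. (-1) ^ m / (fact m)\<^sup>2 * (x / 2) ^ (2 * m))"

lemma summable_bessel_J0:
  "summable (\<lambda>m. (-1) ^ m / (fact m)\<^sup>2 * (x / 2) ^ (2 * m) :: real)"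
proof (rule summable_comparison_test')
  show "summable (\<lambda>m. inverse (fact m) * ((x / 2)\<^sup>2) ^ m)"
    by (rule summable_exp)
  fix m :: nat
  have "(fact m :: real) * 1 \<le> fact m * fact m"
    by (intro mult_left_mono fact_ge_1) simp
  hence "inverse ((fact m :: real)\<^sup>2) \<le> inverse (fact m)"
    unfolding power2_eq_square by (intro le_imp_inverse_le fact_gt_zero) (simp only: mult_1_right)
  hence "inverse ((fact m :: real)\<^sup>2) * ((x / 2)\<^sup>2) ^ m \<le> inverse (fact m) * ((x / 2)\<^sup>2) ^ m"
    by (rule mult_right_mono) (rule zero_le_power[OF zero_le_power2])
  moreover have "norm ((-1) ^ m / (fact m)\<^sup>2 * (x / 2) ^ (2 * m)) =
      inverse ((fact m :: real)\<^sup>2) * ((x / 2)\<^sup>2) ^ m"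
    unfolding power_mult divide_inverse[of "_ ^ m"] norm_mult norm_power
    by (simp only: real_norm_def abs_minus_cancel abs_one power_one mult_1_left power2_abs
        abs_inverse abs_power2)
  ultimately show "norm ((-1) ^ m / (fact m)\<^sup>2 * (x / 2) ^ (2 * m)) \<le> inverse (fact m) * ((x / 2)\<^sup>2) ^ m"
    by (simp only:)
qed

text \<open>Rows and columns are numbered from 0; the entries depend only on the index difference.\<close>
definition jakes_matrix :: "real \<Rightarrow> nat \<Rightarrow> real mat" where
  "jakes_matrix W N =
     mat N N (\<lambda>(m, n). bessel_J0 (2 * pi * W * \<bar>real m - real n\<bar> / (real N - 1)))"

text \<open>The numbers lam 1, ..., lam N list all eigenvalues of the matrix, with multiplicity, in
  non-increasing order. Multiplicities are algebraic; the matrices considered below are real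
  symmetric, so these agree with the geometric ones and the characteristic polynomial splits.\<close>
definition sorted_eigenvalues :: "real mat \<Rightarrow> (nat \<Rightarrow> real) \<Rightarrow> bool" where
  "sorted_eigenvalues A lam \<longleftrightarrow>
     char_poly A = (\<Prod>k = 1..dim_row A. [:- lam k, 1:]) \<and>
     antimono_on {1..dim_row A} lam"

definition num_modes :: "real \<Rightarrow> nat" where
  "num_modes W = 2 * nat \<lceil>W\<rceil> + 1"

definition mode_weight :: "real \<Rightarrow> nat \<Rightarrow> (nat \<Rightarrow> real) \<Rightarrow> nat \<Rightarrow> real" where
  "mode_weight W N lam k = lam k * real (num_modes W) / real N"

definition refined_WIM_outage :: "real \<Rightarrow> nat \<Rightarrow> (nat \<Rightarrow> real) \<Rightarrow> real \<Rightarrow> real" where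
  "refined_WIM_outage W N lam x =
     (\<Prod>k = 1..num_modes W. 1 - exp (- x / mode_weight W N lam k))"

text \<open>The argument of Pout is the average SNR.\<close>
definition has_diversity_order :: "(real \<Rightarrow> real) \<Rightarrow> real \<Rightarrow> bool" where
  "has_diversity_order Pout d \<longleftrightarrow>
     ((\<lambda>\<gamma>. - (ln (Pout \<gamma>) / ln \<gamma>)) \<longlongrightarrow> d) at_top"

end

theory Submission
  imports Defs "HOL-Real_Asymp.Real_Asymp"
begin

text \<open>As the average SNR \<open>\<gamma>\<close> grows, 1 - exp (-c / (b
  \<open>\<gamma>\<close>)) is asymptotic to c / (b \<open>\<gamma>\<close>), so its logarithm is
  -ln \<open>\<gamma>\<close> + O(1): each mode decays with order 1, whatever its positive weight b
  (\<open>single_mode_diversity_order\<close>). Logarithms turn products into sums, so orders add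
  (\<open>has_diversity_order_prod\<close>), and the \<open>num_modes W\<close> factors give the
  claimed order.\<close>

lemma single_mode_diversity_order:
  fixes c b :: real
  assumes "c > 0" and "b > 0"
  shows "has_diversity_order (\<lambda>\<gamma>. 1 - exp (- (c / \<gamma>) / b)) 1"
  unfolding has_diversity_order_def using assms by real_asymp

text \<open>The logarithm of a product splits only where the factors are positive; positivity for
  large \<open>\<gamma>\<close> suffices, as only the limit matters.\<close>

lemma has_diversity_order_prod:
  assumes "\<And>k. k \<in> A \<Longrightarrow> has_diversity_order (P k) (d k)"
    and "\<And>k. k \<in> A \<Longrightarrow> eventually (\<lambda>\<gamma>. P k \<gamma> > 0) at_top"
  shows "has_diversity_order (\<lambda>\<gamma>. \<Prod>k\<in>A. P k \<gamma>) (\<Sum>k\<in>A. d k)"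
proof (cases "finite A")
  case True
  have "((\<lambda>\<gamma>. \<Sum>k\<in>A. - (ln (P k \<gamma>) / ln \<gamma>)) \<longlongrightarrow> (\<Sum>k\<in>A. d k)) at_top"
    using assms(1) unfolding has_diversity_order_def by (intro tendsto_sum)
  \<comment> \<open>Finiteness of \<open>A\<close> gives one threshold beyond which all factors are
    positive.\<close>
  moreover have "eventually (\<lambda>\<gamma>. \<forall>k\<in>A. P k \<gamma> > 0) at_top"
    using True assms(2) by (simp add: eventually_ball_finite)
  hence "eventually (\<lambda>\<gamma>. (\<Sum>k\<in>A. - (ln (P k \<gamma>) / ln \<gamma>)) =
      - (ln (\<Prod>k\<in>A. P k \<gamma>) / ln \<gamma>)) at_top"
    by eventually_elim (subst ln_prod, auto simp: True sum_negf sum_divide_distrib)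
  ultimately show ?thesis
    unfolding has_diversity_order_def by (rule Lim_transform_eventually)
\<comment> \<open>For infinite \<open>A\<close> the product defaults to 1 and the sum to 0, and ln 1
  = 0.\<close>
qed (simp add: has_diversity_order_def)

theorem corollary2:
  fixes W \<gamma>\<^sub>t\<^sub>h :: real and N :: nat and lam :: "nat \<Rightarrow> real"
  assumes "W > 0"
    and "\<gamma>\<^sub>t\<^sub>h > 0"
    and "N \<ge> num_modes W"
    and "sorted_eigenvalues (jakes_matrix W N) lam"
    and "lam N \<ge> 0"
    and "\<And>k. k \<in> {1..num_modes W} \<Longrightarrow> lam k > 0"
  shows "has_diversity_order
           (\<lambda>\<gamma>. refined_WIM_outage W N lam (\<gamma>\<^sub>t\<^sub>h / \<gamma>)) (real (num_modes W))"
proof -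
  have "num_modes W > 0"
    by (simp add: num_modes_def)
  \<comment> \<open>The bound on \<open>N\<close> makes the denominator \<open>real N\<close>
    positive.\<close>
  hence weight: "mode_weight W N lam k > 0" if "k \<in> {1..num_modes W}" for k
    using assms(3) assms(6)[OF that] by (simp add: mode_weight_def)
  \<comment> \<open>The order is kept as a sum of ones to fit the product rule; it evaluates to
    \<open>num_modes W\<close> at the end.\<close>
  have "has_diversity_order
      (\<lambda>\<gamma>. \<Prod>k = 1..num_modes W. 1 - exp (- (\<gamma>\<^sub>t\<^sub>h / \<gamma>) / mode_weight W N lam k))
      (\<Sum>k = 1..num_modes W. 1)"
  proof (rule has_diversity_order_prod)
    fix k assume k: "k \<in> {1..num_modes W}"
    show "has_diversity_order (\<lambda>\<gamma>. 1 - exp (- (\<gamma>\<^sub>t\<^sub>h / \<gamma>) / mode_weight W N lam k)) 1"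
      using assms(2) weight[OF k] by (rule single_mode_diversity_order)
    show "eventually (\<lambda>\<gamma>. 1 - exp (- (\<gamma>\<^sub>t\<^sub>h / \<gamma>) / mode_weight W N lam k) > 0) at_top"
      \<comment> \<open>For \<open>\<gamma>\<close> > 0 the exponent is negative, so the exponential
        is below 1.\<close>
      using eventually_gt_at_top[of 0]
      by eventually_elim (use assms(2) weight[OF k] in simp)
  qed
  thus ?thesis
    by (simp add: refined_WIM_outage_def)
qed

end
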